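(* For every integer $n\ge 1$, the number of irreducible $12312$-avoiding partitions of $[n+1]$ is equal to the number of skew Dyck paths of semilength $n$ ending with a down step, and the number of irreducible $12321$-avoiding partitions of $[n+1]$ is also equal to the number of skew Dyck paths of semilength $n$ ending with a down step.
   Context: A partition of $[m]=\{1,\dots,m\}$ with blocks $B_1,\dots,B_k$ (nonempty, disjoint, with union $[m]$), listed so that $\min B_1<\min B_2<\cdots<\min B_k$, is represented by its canonical sequential form: the word $\pi_1\pi_2\cdots\pi_m$ on $\{1,\dots,k\}$ with $\pi_i=j$ if and only if $i\in B_j$. A partition $\pi$ avoids a partition (pattern) $\tau$ if the word $\pi$ has no (not necessarily contiguous) subsequence order-isomorphic to $\tau$. A partition $P$ of $[m]$ is irreducible if there is no $r\in[m-1]$ such that $P$ splits into a partition of $[r]$ and a partition of $\{r+1,\dots,m\}$ (i.e. such that every block of $P$ is contained in $[r]$ or in $\{r+1,\dots,m\}$). A skew Dyck path is a lattice path in the first quadrant that begins at the origin, ends on the $x$-axis, consists of up steps $U=(1,1)$, down steps $D=(1,-1)$ and left steps $L=(-1,-1)$, never goes below the $x$-axis, and in which up steps and left steps do not overlap (no up step and left step traverse the same unit segment; equivalently, no $U$ is adjacent to an $L$). Its semilength is half its number of steps. *)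

theory Defs
  imports "HOL-Library.Disjoint_Sets" "HOL-Library.Sublist" "HOL-Library.Product_Plus"
begin

definition canonical_blocks :: "nat set set \<Rightarrow> nat set list" where
  "canonical_blocks P = sorted_key_list_of_set Min P"

(* The entries are the 1-based indices j of the blocks B_j; the position i of the word, for i in
   {1..m}, is the list position i - 1. *)
definition canonical_word :: "nat \<Rightarrow> nat set set \<Rightarrow> nat list" where
  "canonical_word m P =
     map (\<lambda>i. THE j. j \<in> {1..length (canonical_blocks P)} \<and> i \<in> canonical_blocks P ! (j - 1))
       [1..<Suc m]"

definition order_isomorphic :: "nat list \<Rightarrow> nat list \<Rightarrow> bool" where
  "order_isomorphic u v \<longleftrightarrow>
     length u = length v \<and> (\<forall>i<length u. \<forall>j<length u. u ! i < u ! j \<longleftrightarrow> v ! i < v ! j)"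

definition word_avoids :: "nat list \<Rightarrow> nat list \<Rightarrow> bool" where
  "word_avoids w \<tau> \<longleftrightarrow> \<not> (\<exists>s. subseq s w \<and> order_isomorphic s \<tau>)"

definition partition_avoids :: "nat \<Rightarrow> nat set set \<Rightarrow> nat list \<Rightarrow> bool" where
  "partition_avoids m P \<tau> \<longleftrightarrow> word_avoids (canonical_word m P) \<tau>"

definition irreducible_partition :: "nat \<Rightarrow> nat set set \<Rightarrow> bool" where
  "irreducible_partition m P \<longleftrightarrow>
     partition_on {1..m} P \<and>
     \<not> (\<exists>r\<in>{1..m - 1}. \<forall>B\<in>P. B \<subseteq> {1..r} \<or> B \<subseteq> {r + 1..m})"

datatype step = Up | Down | Left

fun step_vec :: "step \<Rightarrow> int \<times> int" where
  "step_vec Up = (1, 1)"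
| "step_vec Down = (1, -1)"
| "step_vec Left = (-1, -1)"

definition path_point :: "step list \<Rightarrow> nat \<Rightarrow> int \<times> int" where
  "path_point w i = sum_list (map step_vec (take i w))"

(* A unit segment is identified with the set of its two end points. *)
definition path_segment :: "step list \<Rightarrow> nat \<Rightarrow> (int \<times> int) set" where
  "path_segment w i = {path_point w i, path_point w (Suc i)}"

definition skew_dyck_path :: "step list \<Rightarrow> bool" where
  "skew_dyck_path w \<longleftrightarrow>
     (\<forall>i\<le>length w. 0 \<le> fst (path_point w i) \<and> 0 \<le> snd (path_point w i)) \<and>
     snd (path_point w (length w)) = 0 \<and>
     \<not> (\<exists>i<length w. \<exists>j<length w.
           w ! i = Up \<and> w ! j = Left \<and> path_segment w i = path_segment w j)"

lemma (in linorder) sorted_key_list_of_set_spec: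
  assumes "finite S" and "inj_on f S"
  shows "set (sorted_key_list_of_set f S) = S"
    and "sorted_wrt (<) (map f (sorted_key_list_of_set f S))"
proof -
  interpret folding_insort_key "(\<le>)" "(<)" S f
    by standard (fact assms(2))
  show "set (sorted_key_list_of_set f S) = S"
    using assms(1) by simp
  show "sorted_wrt (<) (map f (sorted_key_list_of_set f S))"
    by simp
qed

lemma canonical_blocks_spec:
  assumes "partition_on {1..m} P"
  shows "set (canonical_blocks P) = P"
    and "sorted_wrt (\<lambda>B C. Min B < Min C) (canonical_blocks P)"
proof -
  have fin: "finite P"
    using assms by (auto intro: finite_elements)
  have blk: "finite B \<and> B \<noteq> {}" if "B \<in> P" for B
    using assms that by (metis finite_atLeastAtMost finite_subset partition_onD1 partition_onD3 Sup_upper)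
  have inj: "inj_on Min P"
  proof (rule inj_onI)
    fix B C assume "B \<in> P" "C \<in> P" "Min B = Min C"
    then have "Min B \<in> B \<inter> C" using blk by (metis IntI Min_in)
    then show "B = C" using \<open>B \<in> P\<close> \<open>C \<in> P\<close> assms
      by (metis disjointD empty_iff partition_onD2)
  qed
  show "set (canonical_blocks P) = P"
    unfolding canonical_blocks_def by (rule sorted_key_list_of_set_spec(1)[OF fin inj])
  have "sorted_wrt (<) (map Min (canonical_blocks P))"
    unfolding canonical_blocks_def by (rule sorted_key_list_of_set_spec(2)[OF fin inj])
  then show "sorted_wrt (\<lambda>B C. Min B < Min C) (canonical_blocks P)"
    by (simp add: sorted_wrt_map)
qed

lemma canonical_word_nth_iff:
  assumes P: "partition_on {1..m} P" and i: "i \<in> {1..m}"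
    and j: "j \<in> {1..length (canonical_blocks P)}"
  shows "canonical_word m P ! (i - 1) = j \<longleftrightarrow> i \<in> canonical_blocks P ! (j - 1)"
proof -
  let ?Bs = "canonical_blocks P"
  let ?Q = "\<lambda>j. j \<in> {1..length ?Bs} \<and> i \<in> ?Bs ! (j - 1)"
  note spec = canonical_blocks_spec[OF P]
  have uniq: "a = b" if "?Q a" "?Q b" for a b
  proof -
    have ab: "a - 1 < length ?Bs" "b - 1 < length ?Bs" using that by auto
    have "?Bs ! (a - 1) \<in> P" "?Bs ! (b - 1) \<in> P"
      using ab spec(1) nth_mem by blast+
    then have eq: "?Bs ! (a - 1) = ?Bs ! (b - 1)"
      using that P by (metis IntI disjointD empty_iff partition_onD2)
    have "a - 1 = b - 1"
      using spec(2) ab eq by (metis less_irrefl nat_neq_iff sorted_wrt_nth_less)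
    then show ?thesis using that by auto
  qed
  obtain B where "B \<in> P" "i \<in> B" using P i by (metis UnionE partition_onD1)
  then obtain k where "k < length ?Bs" "i \<in> ?Bs ! k" using spec(1) by (metis in_set_conv_nth)
  then have "?Q (Suc k)" by auto
  then have ex: "\<exists>!j. ?Q j" using uniq by blast
  have "canonical_word m P ! (i - 1) = (THE j. ?Q j)"
    using i unfolding canonical_word_def by (subst nth_map) (auto simp del: upt_Suc)
  then show ?thesis using theI'[OF ex] uniq j by metis
qed

end

theory Submission
  imports Defs "HOL-Computational_Algebra.Formal_Power_Series"
begin

text \<open>The first return decomposition of skew Dyck paths gives \<open>S = 1 + x S\<^sup>2 + x (S - 1)\<close> for all
  paths and \<open>F = 1 + x S F\<close> for the empty path and those ending with a down step.

  On the other side, build the canonical word of an avoiding partition letter by letter, and label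
  it with the number \<open>h\<close> of letters below its maximum that may still be appended. For both
  patterns the children of a word with label \<open>h\<close> have the labels \<open>h + 1\<close>, \<open>h\<close> and \<open>1, \<dots>, h\<close>, so
  the series \<open>W\<^sub>h\<close> counting the descendants of such a word satisfies a linear recurrence in \<open>h\<close>,
  solved by \<open>W\<^sub>h = W\<^sub>0 S\<^sup>h\<close> with \<open>W\<^sub>0 (1 - x - x S) = 1\<close>. Since every avoiding partition is uniquely
  a direct sum of irreducible avoiding ones, their series \<open>I\<close> is determined by
  \<open>1 + x W\<^sub>0 = 1 / (1 - I)\<close>, whence \<open>I = x / (1 - x S) = x F\<close>.\<close>

unbundle fps_syntax

subsection \<open>Generating functions\<close>

text \<open>Rational coefficients allow series to be inverted, and \<open>of_nat\<close> is
  injective there, so identities of series give back equalities of cardinalities. Since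
  \<open>card\<close> of an infinite set is 0, the rules for unions and products assume finite
  fibres.\<close>

definition gf :: "('a \<Rightarrow> nat) \<Rightarrow> 'a set \<Rightarrow> rat fps" where
  "gf wt A = Abs_fps (\<lambda>n. of_nat (card {x \<in> A. wt x = n}))"

lemma gf_nth: "gf wt A $ n = of_nat (card {x \<in> A. wt x = n})"
  by (simp add: gf_def)

lemma gf_Un:
  assumes "\<And>n. finite {x \<in> A. wt x = n}" "\<And>n. finite {x \<in> B. wt x = n}" "A \<inter> B = {}"
  shows "gf wt (A \<union> B) = gf wt A + gf wt B"
proof (rule fps_ext)
  fix n
  have "{x \<in> A \<union> B. wt x = n} = {x \<in> A. wt x = n} \<union> {x \<in> B. wt x = n}" by blast
  moreover have "card \<dots> = card {x \<in> A. wt x = n} + card {x \<in> B. wt x = n}"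
    using assms by (intro card_Un_disjoint) auto
  ultimately show "gf wt (A \<union> B) $ n = (gf wt A + gf wt B) $ n"
    by (simp add: gf_nth)
qed

lemma gf_singleton: "wt a = 0 \<Longrightarrow> gf wt {a} = 1"
proof (rule fps_ext)
  fix n assume "wt a = 0"
  then have "{x \<in> {a}. wt x = n} = (if n = 0 then {a} else {})" by auto
  then show "gf wt {a} $ n = (1 :: rat fps) $ n" by (simp add: gf_nth)
qed

text \<open>This turns a unique decomposition into a product of series: each fibre is split by the
  weight of the first component, and \<open>c\<close> is the weight that \<open>f\<close> itself
  adds.\<close>

lemma gf_product:
  assumes fin: "\<And>n. finite {x \<in> A. wt x = n}" "\<And>n. finite {x \<in> B. wt x = n}"
    and inj: "inj_on f (A \<times> B)"
    and wt: "\<And>a b. a \<in> A \<Longrightarrow> b \<in> B \<Longrightarrow> wt (f (a, b)) = c + wt a + wt b"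
  shows "gf wt (f ` (A \<times> B)) = fps_X ^ c * gf wt A * gf wt B"
proof (rule fps_ext)
  fix n
  define L where "L = (\<lambda>i. {x \<in> A. wt x = i} \<times> {x \<in> B. wt x = n - c - i})"
  show "gf wt (f ` (A \<times> B)) $ n = (fps_X ^ c * gf wt A * gf wt B) $ n"
  proof (cases "n < c")
    case True
    then have "{x \<in> f ` (A \<times> B). wt x = n} = {}" using wt by auto
    then show ?thesis using True by (simp only: gf_nth mult.assoc) (simp add: fps_X_power_mult_nth)
  next
    case False
    have eq: "{x \<in> f ` (A \<times> B). wt x = n} = f ` (\<Union>i\<in>{0..n - c}. L i)"
    proof (rule set_eqI)
      fix x
      show "x \<in> {x \<in> f ` (A \<times> B). wt x = n} \<longleftrightarrow> x \<in> f ` (\<Union>i\<in>{0..n - c}. L i)"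
      proof
        assume "x \<in> {x \<in> f ` (A \<times> B). wt x = n}"
        then obtain a b where ab: "a \<in> A" "b \<in> B" "x = f (a, b)" "wt x = n" by auto
        then have "(a, b) \<in> L (wt a)" "wt a \<in> {0..n - c}"
          using wt[of a b] by (auto simp: L_def)
        then show "x \<in> f ` (\<Union>i\<in>{0..n - c}. L i)" using ab(3) by blast
      next
        assume "x \<in> f ` (\<Union>i\<in>{0..n - c}. L i)"
        then obtain a b i where ab: "a \<in> A" "b \<in> B" "x = f (a, b)"
            "i \<in> {0..n - c}" "wt a = i" "wt b = n - c - i"
          by (auto simp: L_def)
        then have "wt x = n" using wt[of a b] False by simp
        then show "x \<in> {x \<in> f ` (A \<times> B). wt x = n}" using ab by blast
      qed
    qed
    have "inj_on f (\<Union>i\<in>{0..n - c}. L i)"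
      using inj by (rule inj_on_subset) (auto simp: L_def)
    then have "card {x \<in> f ` (A \<times> B). wt x = n} = card (\<Union>i\<in>{0..n - c}. L i)"
      unfolding eq by (rule card_image)
    also have "\<dots> = (\<Sum>i=0..n - c. card (L i))"
      using fin by (intro card_UN_disjoint) (auto simp: L_def)
    also have "\<dots> = (\<Sum>i=0..n - c. card {x \<in> A. wt x = i} * card {x \<in> B. wt x = n - c - i})"
      by (simp add: L_def card_cartesian_product)
    finally have card: "card {x \<in> f ` (A \<times> B). wt x = n} =
      (\<Sum>i=0..n - c. card {x \<in> A. wt x = i} * card {x \<in> B. wt x = n - c - i})" .
    have "(fps_X ^ c * gf wt A * gf wt B) $ n = (gf wt A * gf wt B) $ (n - c)"
      using False by (simp add: fps_X_power_mult_nth mult.assoc)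
    then show ?thesis by (simp add: gf_nth card fps_mult_nth)
  qed
qed

subsection \<open>Skew Dyck paths\<close>

definition height :: "step list \<Rightarrow> int" where
  "height w = (\<Sum>s\<leftarrow>w. snd (step_vec s))"

lemma height_simps [simp]:
  "height [] = 0" "height (s # w) = snd (step_vec s) + height w"
  "height (u @ v) = height u + height v"
  by (simp_all add: height_def)

text \<open>Down and left steps both lower the height by one, so the up steps and the length
  determine the height. For a path ending on the axis the length is twice the number of up
  steps.\<close>

lemma height_count_Up: "height w = 2 * int (count_list w Up) - int (length w)"
proof (induction w)
  case (Cons s w)
  then show ?case by (cases s) auto
qed simp

text \<open>The starting height is a parameter so that a path can be cut at any point and its pieces
  treated separately.\<close>

fun above :: "int \<Rightarrow> step list \<Rightarrow> bool" where
  "above k [] \<longleftrightarrow> 0 \<le> k"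
| "above k (s # w) \<longleftrightarrow> 0 \<le> k \<and> above (k + snd (step_vec s)) w"

lemma above_start: "above k w \<Longrightarrow> 0 \<le> k"
  by (cases w) auto

lemma above_append: "above k (u @ v) \<longleftrightarrow> above k u \<and> above (k + height u) v"
  by (induction u arbitrary: k) (auto dest: above_start simp: add.assoc)

lemma above_mono: "above k w \<Longrightarrow> k \<le> l \<Longrightarrow> above l w"
proof (induction w arbitrary: k l)
  case (Cons s w)
  from Cons.IH[of "k + snd (step_vec s)" "l + snd (step_vec s)"] Cons.prems show ?case by auto
qed auto

lemma above_iff: "above k w \<longleftrightarrow> (\<forall>i\<le>length w. 0 \<le> k + height (take i w))"
proof (induction w arbitrary: k)
  case (Cons s w)
  have "(\<forall>i\<le>length (s # w). 0 \<le> k + height (take i (s # w))) \<longleftrightarrow>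
      0 \<le> k \<and> (\<forall>i\<le>length w. 0 \<le> k + snd (step_vec s) + height (take i w))"
    (is "?l \<longleftrightarrow> ?r")
  proof
    assume l: ?l
    show ?r
      using l[rule_format, of 0] l[rule_format, of "Suc i" for i] by (auto simp: algebra_simps)
  next
    assume ?r
    then show ?l by (auto simp: take_Cons' algebra_simps)
  qed
  then show ?case by (simp add: Cons.IH)
qed simp

abbreviation no_backtrack :: "step \<Rightarrow> step \<Rightarrow> bool" where
  "no_backtrack s t \<equiv> \<not> (s = Up \<and> t = Left) \<and> \<not> (s = Left \<and> t = Up)"

text \<open>A one-dimensional and local form of \<open>skew_dyck_path\<close>: the abscissa
  disappears, and overlaps are excluded between neighbouring steps only. The equivalence is
  \<open>skew_dyck_path_iff\<close>.\<close>

definition skew_path :: "step list \<Rightarrow> bool" where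
  "skew_path w \<longleftrightarrow> above 0 w \<and> height w = 0 \<and> successively no_backtrack w"

lemma snd_sum_list_step_vec: "snd (sum_list (map step_vec w)) = height w"
  by (induction w) auto

text \<open>Up and left steps move along the diagonal; only a down step changes the difference of
  the coordinates. Hence a nonnegative height forces a nonnegative abscissa.\<close>

lemma fst_sum_list_step_vec:
  "fst (sum_list (map step_vec w)) = height w + 2 * int (count_list w Down)"
proof (induction w)
  case (Cons s w)
  then show ?case by (cases s) auto
qed simp

lemma path_point_eq:
  "path_point w i = (height (take i w) + 2 * int (count_list (take i w) Down), height (take i w))"
  unfolding path_point_def by (simp add: prod_eq_iff snd_sum_list_step_vec fst_sum_list_step_vec)

lemma path_point_Suc: "i < length w \<Longrightarrow> path_point w (Suc i) = path_point w i + step_vec (w ! i)"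
  by (simp add: path_point_def take_Suc_conv_app_nth)

text \<open>Without down steps, two different neighbours would be an up step and a left
  step.\<close>

lemma no_backtrack_constant:
  "successively no_backtrack (s # w) \<Longrightarrow> Down \<notin> set (s # w) \<Longrightarrow> t \<in> set w \<Longrightarrow> t = s"
proof (induction w arbitrary: s)
  case (Cons r w)
  then have "no_backtrack s r" "s \<noteq> Down" "r \<noteq> Down" by auto
  then have "r = s" by (cases s; cases r) auto
  with Cons show ?case by auto
qed simp

text \<open>A subpath returning to its starting point has no down step, since the difference of the
  coordinates increases by 2 with each down step.\<close>

lemma no_overlap:
  assumes suc: "successively no_backtrack w" and ij: "i < j" "j < length w"
    and st: "w ! i = Up \<and> w ! j = Left \<or> w ! i = Left \<and> w ! j = Up" and eq: "path_point w (Suc i) = path_point w j"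
  shows False
proof -
  define v where "v = take (j - Suc i) (drop (Suc i) w)"
  have tj: "take j w = take (Suc i) w @ v"
    unfolding v_def using ij by (metis Suc_leI le_add_diff_inverse take_add)
  have "w = take i w @ (w ! i) # v @ (w ! j) # drop (Suc j) w"
    using tj id_take_nth_drop[of j w] ij by (simp add: take_Suc_conv_app_nth)
  then have "successively no_backtrack (take i w @ ((w ! i) # v @ [w ! j]) @ drop (Suc j) w)"
    using suc by simp
  then have suc': "successively no_backtrack ((w ! i) # v @ [w ! j])"
    unfolding successively_append_iff by blast
  from eq have "count_list v Down = 0"
    unfolding path_point_eq tj by simp
  then have "Down \<notin> set ((w ! i) # v @ [w ! j])"
    using st by (auto simp: count_list_0_iff)
  from no_backtrack_constant[OF suc' this, of "w ! j"] st show False by auto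
qed

text \<open>An up step and an adjacent left step cancel, so they traverse the same segment in
  opposite directions.\<close>

lemma backtrack_overlap:
  assumes "\<not> successively no_backtrack w"
  shows "\<exists>i<length w. \<exists>j<length w. w ! i = Up \<and> w ! j = Left \<and> path_segment w i = path_segment w j"
proof -
  from assms obtain i where i: "Suc i < length w"
      and ul: "w ! i = Up \<and> w ! Suc i = Left \<or> w ! i = Left \<and> w ! Suc i = Up"
    by (auto simp: successively_conv_nth)
  have p: "path_point w (Suc i) = path_point w i + step_vec (w ! i)"
    "path_point w (Suc (Suc i)) = path_point w i + step_vec (w ! i) + step_vec (w ! Suc i)"
    using i by (simp_all add: path_point_Suc)
  from ul have "path_point w (Suc (Suc i)) = path_point w i"
    by (auto simp: p prod_eq_iff)
  then have "path_segment w i = path_segment w (Suc i)"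
    by (auto simp: path_segment_def)
  then show ?thesis using ul i by (metis Suc_lessD)
qed

lemma skew_dyck_path_iff: "skew_dyck_path w \<longleftrightarrow> skew_path w"
proof -
  have "(\<forall>i\<le>length w. 0 \<le> fst (path_point w i) \<and> 0 \<le> snd (path_point w i)) \<longleftrightarrow> above 0 w"
    by (auto simp: path_point_eq above_iff)
  moreover have "snd (path_point w (length w)) = height w" by (simp add: path_point_eq)
  moreover have "(\<exists>i<length w. \<exists>j<length w.
      w ! i = Up \<and> w ! j = Left \<and> path_segment w i = path_segment w j) \<longleftrightarrow>
    \<not> successively no_backtrack w" (is "?l \<longleftrightarrow> ?r")
  proof
    assume ?l
    then obtain i j where ij: "i < length w" "j < length w" "w ! i = Up" "w ! j = Left"
      "path_segment w i = path_segment w j" by blast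
    have "path_point w (Suc i) = path_point w i + (1, 1)"
      "path_point w (Suc j) = path_point w j + (-1, -1)"
      using ij by (simp_all add: path_point_Suc)
    \<comment> \<open>The alternative, equal starting points and equal end points, is impossible
      because the two step vectors differ. So the path between the two steps is closed, whichever
      comes first.\<close>
    then have "path_point w (Suc i) = path_point w j \<and> path_point w (Suc j) = path_point w i"
      using ij(5) by (auto simp: path_segment_def doubleton_eq_iff prod_eq_iff)
    moreover have "i \<noteq> j" using ij by auto
    ultimately show ?r
      using no_overlap[of w i j] no_overlap[of w j i] ij
      by (metis nat_neq_iff)
  qed (rule backtrack_overlap)
  ultimately show ?thesis by (simp only: skew_dyck_path_def skew_path_def not_not)
qed

section \<open>First return decomposition of skew Dyck paths\<close>

lemma height_negative_split:
  assumes "height v < 0"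
  shows "\<exists>a s b. v = a @ s # b \<and> above 0 a \<and> height a = 0 \<and> s \<noteq> Up"
proof -
  \<comment> \<open>The cut is at the first step to reach a negative height; as heights change by
    one, that step starts at height 0.\<close>
  define k where "k = (LEAST k. height (take k v) < 0)"
  have k: "height (take k v) < 0"
    unfolding k_def by (rule LeastI[of _ "length v"]) (use assms in simp)
  have least: "0 \<le> height (take i v)" if "i < k" for i
    using not_less_Least[OF that[unfolded k_def]] by simp
  have "k \<le> length v"
    unfolding k_def using assms by (intro Least_le) simp
  moreover have "k \<noteq> 0" using k by (cases "k = 0") auto
  ultimately obtain l where l: "k = Suc l" "l < length v" by (cases k) auto
  have "height (take l v) + snd (step_vec (v ! l)) < 0"
    using k l by (simp add: take_Suc_conv_app_nth)
  moreover have "0 \<le> height (take l v)" using least l by simp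
  ultimately have "height (take l v) = 0" "v ! l \<noteq> Up"
    by (cases "v ! l"; simp)+
  moreover have "above 0 (take l v)"
    using least l by (auto simp: above_iff min_def)
  moreover have "v = take l v @ v ! l # drop (Suc l) v"
    using l id_take_nth_drop by blast
  ultimately show ?thesis by blast
qed

lemma skew_path_hd: "skew_path w \<Longrightarrow> w \<noteq> [] \<Longrightarrow> hd w = Up"
proof (cases w)
  case (Cons s v)
  assume "skew_path w"
  then have "0 \<le> snd (step_vec s)"
    using Cons above_start by (fastforce simp: skew_path_def)
  then show ?thesis using Cons by (cases s) auto
qed simp

lemma skew_path_last: "skew_path w \<Longrightarrow> w \<noteq> [] \<Longrightarrow> last w \<noteq> Up"
proof (cases w rule: rev_cases)
  case (snoc v s)
  assume "skew_path w"
  then have "0 \<le> height v" "height v + snd (step_vec s) = 0"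
    using snoc by (auto simp: skew_path_def above_append)
  then show ?thesis using snoc by (cases s) auto
qed simp

lemma skew_path_Nil: "skew_path []"
  by (simp add: skew_path_def)

text \<open>A nonempty \<open>a\<close> starts with an up step and does not end with one, so both of
  its junctions are harmless. Only an up step directly followed by a left step has to be
  excluded.\<close>

lemma successively_Up_append:
  assumes "skew_path a" "successively no_backtrack (s # b)" "s \<noteq> Up" "a = [] \<longrightarrow> s \<noteq> Left"
  shows "successively no_backtrack (Up # a @ s # b)"
proof -
  have "successively no_backtrack (a @ s # b)"
  proof (cases "a = []")
    case False
    then have "no_backtrack (last a) s"
      using assms(1,3) skew_path_last[of a] by simp
    then show ?thesis
      using assms(1,2) by (simp add: skew_path_def successively_append_iff)
  qed (use assms in simp)
  moreover have "no_backtrack Up (hd (a @ s # b))"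
    using assms skew_path_hd[of a] by (cases "a = []") simp_all
  ultimately show ?thesis by (simp only: successively_Cons) simp
qed

lemma skew_path_Down:
  assumes a: "skew_path a" and b: "skew_path b"
  shows "skew_path (Up # a @ Down # b)"
proof -
  have "successively no_backtrack (Down # b)"
    using b by (auto simp: skew_path_def successively_Cons)
  then have "successively no_backtrack (Up # a @ Down # b)"
    using a by (intro successively_Up_append) simp_all
  moreover have "above 1 a" using a above_mono[of 0 a 1] by (simp add: skew_path_def)
  ultimately show ?thesis using a b by (simp add: skew_path_def above_append)
qed

lemma skew_path_Left:
  assumes a: "skew_path a" "a \<noteq> []"
  shows "skew_path (Up # a @ [Left])"
proof -
  have "successively no_backtrack (Up # a @ [Left])"
    using a by (intro successively_Up_append) simp_all
  moreover have "above 1 a" using a above_mono[of 0 a 1] by (simp add: skew_path_def)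
  ultimately show ?thesis using a by (simp add: skew_path_def above_append)
qed

text \<open>The first return to the axis is a down or a left step. After a left step the path must
  stop, since on the axis only an up step could follow; and a left step cannot directly follow the
  initial up step, so \<open>a\<close> is nonempty.\<close>

lemma skew_path_first_return:
  assumes w: "skew_path w" "w \<noteq> []"
  shows "(\<exists>a b. w = Up # a @ Down # b \<and> skew_path a \<and> skew_path b) \<or>
    (\<exists>a. w = Up # a @ [Left] \<and> skew_path a \<and> a \<noteq> [])"
proof -
  obtain v where v: "w = Up # v" using w skew_path_hd by (metis list.collapse)
  then have "height v < 0" using w by (simp add: skew_path_def)
  then obtain a s b where vs: "v = a @ s # b" and a: "above 0 a" "height a = 0" and s: "s \<noteq> Up"
    using height_negative_split by blast
  have s': "snd (step_vec s) = -1" using s by (cases s) auto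
  have b: "above 0 b" "height b = 0"
    using w s' a by (auto simp: v vs skew_path_def above_append)
  have suc: "successively no_backtrack (Up # a @ s # b)"
    using w by (simp add: v vs skew_path_def)
  then have sa: "successively no_backtrack a" and sb: "successively no_backtrack b"
    by (auto simp: successively_Cons successively_append_iff)
  have pa: "skew_path a" and pb: "skew_path b"
    using a b sa sb by (auto simp: skew_path_def)
  show ?thesis
  proof (cases s)
    case Left
    then have "a \<noteq> []" using suc by auto
    moreover have "b = []"
    proof (rule ccontr)
      assume "b \<noteq> []"
      moreover from this have "hd b = Up" using pb skew_path_hd by blast
      ultimately show False
        using suc Left by (auto simp: successively_Cons successively_append_iff)
    qed
    ultimately show ?thesis using pa v vs Left by auto
  next
    case Down
    then show ?thesis using pa pb v vs by blast
  qed (use s in simp)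
qed

text \<open>If one of the two prefixes were shorter, the descending step after it would start at
  height 0 inside the longer one and lead below the axis.\<close>

lemma first_return_unique:
  assumes "skew_path a" "skew_path a'" "s \<noteq> Up" "s' \<noteq> Up" "a @ s # b = a' @ s' # b'"
  shows "a = a' \<and> s = s' \<and> b = b'"
proof -
  have False if eq: "x @ t # y = x' @ t' # y'" "length x < length x'"
    and x: "skew_path x" "skew_path x'" "t \<noteq> Up" for x x' :: "step list" and t t' y y'
  proof -
    have "x = take (length x) x'" "t = x' ! length x"
      using arg_cong[OF eq(1), of "take (length x)"] arg_cong[OF eq(1), of "\<lambda>l. l ! length x"] eq(2)
      by (simp_all add: nth_append)
    then have x': "x' = x @ t # drop (Suc (length x)) x'"
      using id_take_nth_drop[OF eq(2)] by simp
    have "above 0 (x @ t # drop (Suc (length x)) x')" "height x = 0"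
      using x unfolding skew_path_def x'[symmetric] by blast+
    then have "0 \<le> snd (step_vec t)"
      using above_start[of "snd (step_vec t)"] by (auto simp: above_append)
    then show False using x by (cases t) auto
  qed
  then have "length a = length a'" using assms by (metis nat_neq_iff)
  then show ?thesis using assms(5) by simp
qed

section \<open>Generating functions of skew Dyck paths\<close>

definition skew_paths :: "step list set" where
  "skew_paths = {w. skew_path w}"

definition skew_paths_D :: "step list set" where
  "skew_paths_D = {w. skew_path w \<and> (w \<noteq> [] \<longrightarrow> last w = Down)}"

text \<open>Counting up steps gives a weight that is additive under concatenation; by
  \<open>length_eq_semilength\<close> it is half the length of a skew path.\<close>

abbreviation semilength :: "step list \<Rightarrow> nat" where
  "semilength w \<equiv> count_list w Up"

lemma length_eq_semilength: "skew_path w \<Longrightarrow> length w = 2 * semilength w"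
  using height_count_Up[of w] by (simp add: skew_path_def)

instance step :: finite
proof
  have "(UNIV :: step set) = {Up, Down, Left}" using step.exhaust by blast
  then show "finite (UNIV :: step set)" by (metis finite.simps)
qed

lemma finite_skew_paths:
  assumes "A \<subseteq> skew_paths"
  shows "finite {w \<in> A. semilength w = n}"
proof -
  have "{w \<in> A. semilength w = n} \<subseteq> {w. set w \<subseteq> UNIV \<and> length w = 2 * n}"
    using assms length_eq_semilength by (auto simp: skew_paths_def)
  then show ?thesis by (rule finite_subset) (intro finite_lists_length_eq finite)
qed

abbreviation first_return :: "step list \<times> step list \<Rightarrow> step list" where
  "first_return \<equiv> \<lambda>(a, b). Up # a @ Down # b"

lemma inj_first_return: "B \<subseteq> skew_paths \<Longrightarrow> inj_on first_return (skew_paths \<times> B)"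
  by (rule inj_onI) (auto simp: skew_paths_def dest: first_return_unique)

text \<open>The three summands are the empty path, a first return by a down step, and one by a left
  step. The last is linear in \<open>S - 1\<close>, since the left step ends the path and encloses a
  nonempty one.\<close>

lemma gf_skew_paths:
  defines "S \<equiv> gf semilength skew_paths"
  shows "S = 1 + fps_X * S * S + fps_X * (S - 1)"
proof -
  let ?D = "first_return ` (skew_paths \<times> skew_paths)"
  \<comment> \<open>The second component is a dummy ranging over \<open>{[]}\<close>, so that
    \<open>gf_product\<close> applies to this case too.\<close>
  let ?f = "\<lambda>(a, b :: step list). Up # a @ [Left]"
  let ?L = "?f ` ((skew_paths - {[]}) \<times> {[]})"
  have eq: "skew_paths = {[]} \<union> (?D \<union> ?L)"
  proof (rule set_eqI)
    fix w show "w \<in> skew_paths \<longleftrightarrow> w \<in> {[]} \<union> (?D \<union> ?L)"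
      unfolding skew_paths_def
      using skew_path_first_return[of w] skew_path_Nil skew_path_Down skew_path_Left
      by (cases "w = []") auto
  qed
  have "?D \<inter> ?L = {}"
  proof -
    have False if "skew_path a" "skew_path a'" "a @ Down # b = a' @ [Left]" for a a' b
      using first_return_unique[OF that(1,2) _ _ that(3)] by auto
    then show ?thesis by (auto simp: skew_paths_def)
  qed
  moreover have sub: "?D \<subseteq> skew_paths" "?L \<subseteq> skew_paths" using eq by blast+
  ultimately have DL: "gf semilength (?D \<union> ?L) = gf semilength ?D + gf semilength ?L"
    by (intro gf_Un finite_skew_paths)
  have "S = gf semilength ({[]} \<union> (?D \<union> ?L))" unfolding S_def using eq by (rule arg_cong)
  also have "\<dots> = gf semilength {[]} + gf semilength (?D \<union> ?L)"
    using sub by (intro gf_Un finite_skew_paths) (auto simp: skew_paths_def skew_path_Nil)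
  also have "gf semilength {[]} = 1" by (rule gf_singleton) simp
  also note DL
  also have "gf semilength ?D = fps_X ^ 1 * S * S"
    unfolding S_def by (intro gf_product inj_first_return finite_skew_paths) auto
  also have "gf semilength ?L = fps_X ^ 1 * gf semilength (skew_paths - {[]}) * gf semilength {[]}"
    by (intro gf_product finite_skew_paths) (auto simp: inj_on_def skew_paths_def skew_path_Nil)
  also have "gf semilength (skew_paths - {[]}) = S - 1"
  proof -
    have "skew_paths = {[]} \<union> (skew_paths - {[]})" by (auto simp: skew_paths_def skew_path_Nil)
    then have "S = gf semilength ({[]} \<union> (skew_paths - {[]}))"
      unfolding S_def by (rule arg_cong)
    also have "\<dots> = gf semilength {[]} + gf semilength (skew_paths - {[]})"
      by (intro gf_Un finite_skew_paths) (auto simp: skew_paths_def skew_path_Nil)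
    finally have "S = gf semilength {[]} + gf semilength (skew_paths - {[]})" .
    then show ?thesis by (simp add: gf_singleton)
  qed
  finally show ?thesis by (simp add: gf_singleton add.assoc)
qed

text \<open>A path closed by a left step is ruled out, and \<open>Up # a @ Down # b\<close> ends
  with a down step exactly if \<open>b\<close> is empty or does so itself.\<close>

lemma gf_skew_paths_D:
  defines "S \<equiv> gf semilength skew_paths" and "F \<equiv> gf semilength skew_paths_D"
  shows "F = 1 + fps_X * S * F"
proof -
  let ?D = "first_return ` (skew_paths \<times> skew_paths_D)"
  have eq: "skew_paths_D = {[]} \<union> ?D"
  proof (intro equalityI subsetI)
    fix w assume w: "w \<in> skew_paths_D"
    show "w \<in> {[]} \<union> ?D"
    proof (cases "w = []")
      case False
      with w obtain a b where "w = first_return (a, b)" "skew_path a" "skew_path b"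
        using skew_path_first_return[of w] by (auto simp: skew_paths_D_def)
      moreover from this have "b \<in> skew_paths_D"
        using w by (auto simp: skew_paths_D_def)
      ultimately show ?thesis by (auto simp: skew_paths_def)
    qed simp
  next
    fix w assume "w \<in> {[]} \<union> ?D"
    then show "w \<in> skew_paths_D"
      by (auto simp: skew_paths_D_def skew_paths_def skew_path_Nil skew_path_Down)
  qed
  have sub: "skew_paths_D \<subseteq> skew_paths" by (auto simp: skew_paths_def skew_paths_D_def)
  have "F = gf semilength ({[]} \<union> ?D)" unfolding F_def using eq by (rule arg_cong)
  also have "\<dots> = gf semilength {[]} + gf semilength ?D"
    using sub eq by (intro gf_Un finite_skew_paths) auto
  also have "gf semilength {[]} = 1" by (rule gf_singleton) simp
  also have "gf semilength ?D = fps_X ^ 1 * S * F"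
    unfolding S_def F_def by (intro gf_product inj_first_return finite_skew_paths sub) auto
  finally show ?thesis by simp
qed

subsection \<open>Restricted growth functions\<close>

text \<open>Restricted growth is stated through prefixes: their letters always form an initial
  interval. Thus \<open>card (set w)\<close> is the maximal letter, and it also makes sense for the
  empty word.\<close>

definition rgf :: "nat list \<Rightarrow> bool" where
  "rgf w \<longleftrightarrow> (\<forall>u. prefix u w \<longrightarrow> set u = {1..card (set u)})"

lemma rgf_Nil: "rgf []"
  by (simp add: rgf_def)

lemma rgf_set: "rgf w \<Longrightarrow> set w = {1..card (set w)}"
  by (simp add: rgf_def)

lemma rgf_mem_iff: "rgf w \<Longrightarrow> a \<in> set w \<longleftrightarrow> 1 \<le> a \<and> a \<le> card (set w)"
  by (metis atLeastAtMost_iff rgf_set)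

lemma rgf_append: "rgf (u @ v) \<Longrightarrow> rgf u"
  by (auto simp: rgf_def)

lemma rgf_snoc: "rgf (w @ [a]) \<longleftrightarrow> rgf w \<and> 1 \<le> a \<and> a \<le> Suc (card (set w))"
proof -
  have "rgf (w @ [a]) \<longleftrightarrow> rgf w \<and> insert a (set w) = {1..card (insert a (set w))}"
    unfolding rgf_def by (auto simp: prefix_snoc)
  moreover have "insert a (set w) = {1..card (insert a (set w))} \<longleftrightarrow> 1 \<le> a \<and> a \<le> Suc (card (set w))"
    if "rgf w"
  proof (cases "a \<in> set w")
    case True
    then show ?thesis using rgf_mem_iff[OF that, of a] rgf_set[OF that] by (simp add: insert_absorb)
  next
    case False
    then have card: "card (insert a (set w)) = Suc (card (set w))" by simp
    have "insert a (set w) = insert a {1..card (set w)}" using rgf_set[OF that] by simp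
    moreover have "{1..Suc (card (set w))} = insert (Suc (card (set w))) {1..card (set w)}"
      by auto
    moreover have "insert a {1..card (set w)} = insert (Suc (card (set w))) {1..card (set w)}
        \<longleftrightarrow> a = Suc (card (set w))"
      using False rgf_mem_iff[OF that, of a] by (metis atLeastAtMost_iff insertE insertI1)
    ultimately have "insert a (set w) = {1..Suc (card (set w))} \<longleftrightarrow> a = Suc (card (set w))" by simp
    then show ?thesis using False rgf_mem_iff[OF that, of a] unfolding card by linarith
  qed
  ultimately show ?thesis by blast
qed

text \<open>New letters arrive in increasing order, so the first occurrences form this
  subsequence.\<close>

lemma rgf_subseq_upt: "rgf w \<Longrightarrow> subseq [1..<Suc (card (set w))] w"
proof (induction w rule: rev_induct)
  case (snoc a w)
  then have w: "rgf w" "1 \<le> a" "a \<le> Suc (card (set w))" by (simp_all add: rgf_snoc)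
  then have IH: "subseq [1..<Suc (card (set w))] w" using snoc.IH by blast
  show ?case
  proof (cases "a \<in> set w")
    case True
    then show ?thesis using IH by (simp add: insert_absorb subseq_rev_drop_many del: upt_Suc)
  next
    case False
    then have "a = Suc (card (set w))" using w rgf_mem_iff[OF w(1)] by auto
    then show ?thesis using IH False by (auto simp: list_emb_append_mono)
  qed
qed simp

text \<open>As \<open>v\<close> has no letter 0, its shifted letters all exceed those of
  \<open>u\<close>. The growth condition on the second part is then that of \<open>v\<close>, raised
  by \<open>card (set u)\<close>.\<close>

lemma rgf_sum:
  assumes u: "rgf u" and v: "0 \<notin> set v"
  shows "rgf (u @ map ((+) (card (set u))) v) \<longleftrightarrow> rgf v"
  using v
proof (induction v rule: rev_induct)
  case (snoc a v)
  let ?k = "card (set u)"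
  let ?w = "u @ map ((+) ?k) v"
  have IH: "rgf ?w \<longleftrightarrow> rgf v" and a: "1 \<le> a" using snoc by auto
  have "card (set ?w) = ?k + card (set v)" if "rgf v"
  proof -
    have "set u \<inter> (+) ?k ` set v = {}"
      using rgf_mem_iff[OF u] rgf_mem_iff[OF that] by auto
    then show ?thesis by (simp add: card_Un_disjoint card_image)
  qed
  moreover have "u @ map ((+) ?k) (v @ [a]) = ?w @ [?k + a]" by simp
  ultimately show ?case using IH a by (auto simp only: rgf_snoc)
qed (simp add: u rgf_Nil)

text \<open>The letters of \<open>u\<close> fill an initial interval, so those of a disjoint
  \<open>z\<close> lie above it and can be shifted down.\<close>

lemma rgf_tail:
  assumes w: "rgf (u @ z)" and disj: "set u \<inter> set z = {}"
  shows "\<exists>v. z = map ((+) (card (set u))) v \<and> rgf v"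
proof -
  have u: "rgf u" using w by (rule rgf_append)
  have z: "card (set u) < a" if "a \<in> set z" for a
    using that disj rgf_mem_iff[OF u, of a] rgf_mem_iff[OF w, of a] by auto
  define v where "v = map (\<lambda>a. a - card (set u)) z"
  have "map ((+) (card (set u))) v = z"
    unfolding v_def by (simp add: map_idI less_imp_le z)
  moreover have "0 \<notin> set v" by (auto simp: v_def dest!: z)
  ultimately show ?thesis using rgf_sum[OF u, of v] w by metis
qed

lemma rgf_positive: "rgf w \<Longrightarrow> 0 \<notin> set w"
  by (simp add: rgf_mem_iff)

lemma finite_rgf: "finite {w. rgf w \<and> length w = n}"
proof -
  have "set w \<subseteq> {1..length w}" if "rgf w" for w
    using rgf_mem_iff[OF that] card_length[of w] by fastforce
  then have "{w. rgf w \<and> length w = n} \<subseteq> {w. set w \<subseteq> {1..n} \<and> length w = n}" by auto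
  then show ?thesis by (rule finite_subset) (intro finite_lists_length_eq finite_atLeastAtMost)
qed

text \<open>Every cut separates two occurrences of some letter, that is, it splits a block. The
  empty word qualifies vacuously and is excluded in \<open>irreducible_good\<close>.\<close>

definition irreducible_word :: "nat list \<Rightarrow> bool" where
  "irreducible_word w \<longleftrightarrow> (\<forall>r\<in>{1..<length w}. set (take r w) \<inter> set (drop r w) \<noteq> {})"

text \<open>The shift keeps the letters of the two summands disjoint, so no block crosses the cut.
  The function takes a pair to fit \<open>gf_product\<close>.\<close>

definition direct_sum :: "nat list \<times> nat list \<Rightarrow> nat list" where
  "direct_sum = (\<lambda>(u, v). u @ map ((+) (card (set u))) v)"

subsection \<open>Counting walks\<close>

text \<open>The number of nodes \<open>m\<close> levels below a node labelled \<open>h\<close> in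
  the generating tree with rule h -> h + 1, h, 1, ..., h.\<close>

fun walks :: "nat \<Rightarrow> nat \<Rightarrow> nat" where
  "walks 0 h = 1"
| "walks (Suc m) h = walks m (Suc h) + walks m h + (\<Sum>j=1..h. walks m j)"

definition walk_series :: "nat \<Rightarrow> rat fps" where
  "walk_series h = Abs_fps (\<lambda>m. of_nat (walks m h))"

text \<open>The equation for \<open>S\<close> makes \<open>S ^ h\<close> a solution of the linear recurrence in \<open>h\<close> obtained by
  differencing the defining system of \<open>walks\<close>; the constant factor is fixed by \<open>h = 0\<close>.\<close>

lemma walk_series_power:
  fixes S :: "rat fps"
  assumes S: "S = 1 + fps_X * S * S + fps_X * (S - 1)"
  shows "walk_series 0 * (1 - fps_X - fps_X * S) = 1"
proof -
  \<comment> \<open>The inverted series has constant term 1, and its inverse solves V 0 = 1 + X (S V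
    0 + V 0), the case \<open>h = 0\<close>.\<close>
  define V where "V = (\<lambda>h. inverse (1 - fps_X - fps_X * S) * S ^ h)"
  have V0: "V 0 * (1 - fps_X - fps_X * S) = 1"
    unfolding V_def by (simp add: inverse_mult_eq_1)
  have V: "V h = 1 + fps_X * (V (Suc h) + V h + (\<Sum>j=1..h. V j))" for h
  proof (induction h)
    case 0
    have "V (Suc 0) = V 0 * S" by (simp add: V_def)
    then show ?case using V0 by (simp add: algebra_simps)
  next
    case (Suc h)
    have "V (Suc h) = V h * S" "V (Suc (Suc h)) = V h * S * S" by (simp_all add: V_def)
    moreover have "V h * S = V h * (1 + fps_X * S * S + fps_X * (S - 1))"
      using S by (rule arg_cong)
    ultimately have "V (Suc h) = V h + fps_X * (V (Suc (Suc h)) + V (Suc h) - V h)"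
      by (simp add: algebra_simps)
    also have "\<dots> = 1 + fps_X * (V (Suc h) + V h + (\<Sum>j=1..h. V j))
        + fps_X * (V (Suc (Suc h)) + V (Suc h) - V h)"
      by (subst (1) Suc.IH) (rule refl)
    finally show ?case by (simp add: algebra_simps)
  qed
  \<comment> \<open>The factor \<open>fps_X\<close> makes coefficient m + 1 depend on coefficients m
    only, so the system has a single solution.\<close>
  have "V h $ m = of_nat (walks m h)" for m h
  proof (induction m arbitrary: h)
    case 0
    show ?case by (subst V) simp
  next
    case (Suc m)
    show ?case by (subst V) (simp add: Suc.IH fps_sum_nth)
  qed
  then have "walk_series 0 = V 0" by (simp add: walk_series_def fps_eq_iff)
  then show ?thesis using V0 by simp
qed

subsection \<open>Appending letters to avoiding words\<close>

lemma subseq_snoc: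
  "subseq (xs @ [x]) (w @ [y]) \<longleftrightarrow> subseq (xs @ [x]) w \<or> x = y \<and> subseq xs w"
proof -
  have single: "subseq zs [y] \<longleftrightarrow> zs = [] \<or> zs = [y]" for zs by (cases zs) auto
  have "subseq (xs @ [x]) (w @ [y]) \<longleftrightarrow>
      subseq (xs @ [x]) w \<or> (\<exists>xs1. xs @ [x] = xs1 @ [y] \<and> subseq xs1 w)"
    unfolding subseq_append_iff[of _ w "[y]"] single by (metis append_Nil2)
  then show ?thesis by (simp add: conj_commute)
qed

lemma subseq_set: "subseq xs ys \<Longrightarrow> set xs \<subseteq> set ys"
  by (auto simp: subseq_conv_nths dest: in_set_nthsD)

text \<open>Taking an arbitrary strict linear order treats both patterns at once. Transitivity and
  totality serve to rank active letters; \<open>shift\<close> is what direct sums require.\<close>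

locale strict_linear =
  fixes R :: "nat \<Rightarrow> nat \<Rightarrow> bool"
  assumes irrefl: "\<not> R a a"
    and shift: "R (k + a) (k + b) \<longleftrightarrow> R a b"
    and trans: "R a b \<Longrightarrow> R b c \<Longrightarrow> R a c"
    and total: "a \<noteq> b \<Longrightarrow> R a b \<or> R b a"
begin

text \<open>In a restricted growth function the first occurrences of the letters below \<open>c\<close> precede \<open>c\<close>, so
  containing 12312 (12321) amounts to containing 312 (321). Below, \<open>R\<close> is \<open><\<close> in the former case
  and \<open>>\<close> in the latter.\<close>

definition good :: "nat list \<Rightarrow> bool" where
  "good w \<longleftrightarrow> rgf w \<and> \<not> (\<exists>c x y. x < c \<and> y < c \<and> R x y \<and> subseq [c, x, y] w)"

text \<open>A letter below the maximum is left out exactly when appending it would complete an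
  occurrence \<open>c x a\<close>. The number of active letters is the label in the generating
  tree.\<close>

definition active :: "nat list \<Rightarrow> nat set" where
  "active w = {a. 1 \<le> a \<and> a < card (set w) \<and> \<not> (\<exists>x c. x < c \<and> a < c \<and> R x a \<and> subseq [c, x] w)}"

lemma finite_active: "finite (active w)"
  by (rule finite_subset[of _ "{..<card (set w)}"]) (auto simp: active_def)

lemma good_append: "good (u @ v) \<Longrightarrow> good u"
  unfolding good_def using rgf_append subseq_rev_drop_many by blast

lemma subseq_snoc2: "subseq [c, x] (w @ [y]) \<longleftrightarrow> subseq [c, x] w \<or> x = y \<and> c \<in> set w"
  using subseq_snoc[of "[c]" x w y] by (simp add: subseq_singleton_left)

lemma subseq_snoc3: "subseq [c, x, z] (w @ [y]) \<longleftrightarrow> subseq [c, x, z] w \<or> z = y \<and> subseq [c, x] w"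
  using subseq_snoc[of "[c, x]" z w y] by simp

lemma subseq2_set: "subseq [c, x] w \<Longrightarrow> c \<in> set w \<and> x \<in> set w"
  by (drule subseq_set) simp

text \<open>A letter that is at least the current maximum cannot end an occurrence, since no earlier
  \<open>c\<close> exceeds it.\<close>

lemma good_snoc:
  assumes "good w" "w \<noteq> []"
  shows "good (w @ [a]) \<longleftrightarrow> a \<in> insert (Suc (card (set w))) (insert (card (set w)) (active w))"
proof -
  have w: "rgf w" using assms by (simp add: good_def)
  have 1: "1 \<le> card (set w)" using assms by (simp add: Suc_le_eq card_gt_0_iff)
  have "good (w @ [a]) \<longleftrightarrow> 1 \<le> a \<and> a \<le> Suc (card (set w)) \<and>
      \<not> (\<exists>c x. x < c \<and> a < c \<and> R x a \<and> subseq [c, x] w)"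
    using assms unfolding good_def rgf_snoc subseq_snoc3 by blast
  moreover have "\<not> a < c" if "a \<ge> card (set w)" "subseq [c, x] w" for c x
    using subseq2_set[OF that(2)] rgf_mem_iff[OF w] that(1) by auto
  ultimately show ?thesis using 1 unfolding active_def
    by (cases "a < card (set w)") (auto simp: le_Suc_eq)
qed

lemma active_snoc_max:
  assumes "rgf w" "w \<noteq> []"
  shows "active (w @ [card (set w)]) = active w"
proof -
  have "card (set w) \<in> set w"
    using assms rgf_mem_iff by (auto simp: Suc_le_eq card_gt_0_iff)
  then show ?thesis
    unfolding active_def subseq_snoc2 using rgf_mem_iff[OF assms(1)] by (auto simp: insert_absorb)
qed

text \<open>The new letter is larger than everything before it, so it creates no descending pair;
  the old maximum merely drops below the new one and becomes active.\<close>

lemma active_snoc_new: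
  assumes "rgf w" "w \<noteq> []"
  shows "active (w @ [Suc (card (set w))]) = insert (card (set w)) (active w)"
proof -
  have mem: "a \<in> set w \<longleftrightarrow> 1 \<le> a \<and> a \<le> card (set w)" for a using rgf_mem_iff[OF assms(1)] .
  have 1: "1 \<le> card (set w)" using assms by (simp add: Suc_le_eq card_gt_0_iff)
  have c: "card (set (w @ [Suc (card (set w))])) = Suc (card (set w))" using mem by simp
  have le: "c \<le> card (set w)" if "subseq [c, x] w" for c x using subseq2_set[OF that] mem by blast
  show ?thesis unfolding active_def c subseq_snoc2
    using 1 le mem by (force simp: less_Suc_eq)
qed

text \<open>Appending \<open>a\<close> creates the pairs \<open>c a\<close>. The maximum of the word
  serves as \<open>c\<close> for all active letters at once, so exactly the letters \<open>x\<close>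
  with \<open>R a x\<close> are lost.\<close>

lemma active_snoc_active:
  assumes "rgf w" "a \<in> active w"
  shows "active (w @ [a]) = {x \<in> active w. \<not> R a x}"
proof -
  have mem: "a \<in> set w \<longleftrightarrow> 1 \<le> a \<and> a \<le> card (set w)" for a using rgf_mem_iff[OF assms(1)] .
  have a: "1 \<le> a" "a < card (set w)" using assms(2) by (auto simp: active_def)
  then have c: "card (set (w @ [a])) = card (set w)" using mem by (simp add: insert_absorb)
  have max: "card (set w) \<in> set w" using a mem by auto
  show ?thesis unfolding active_def c subseq_snoc2
    using a max by (auto dest: mem[THEN iffD1])
qed

text \<open>The cardinality is the rank of \<open>a\<close> in \<open>A\<close> with respect to
  \<open>R\<close>, counting \<open>a\<close> itself, hence ranks start at 1.\<close>

lemma bij_betw_card_below: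
  assumes "finite A"
  shows "bij_betw (\<lambda>a. card {x \<in> A. \<not> R a x}) A {1..card A}"
proof -
  let ?f = "\<lambda>a. card {x \<in> A. \<not> R a x}"
  have less: "?f a < ?f b" if "a \<in> A" "b \<in> A" "R a b" for a b
  proof (rule psubset_card_mono)
    show "{x \<in> A. \<not> R a x} \<subset> {x \<in> A. \<not> R b x}" using that irrefl trans by blast
  qed (simp add: assms)
  have inj: "inj_on ?f A"
  proof (rule inj_onI, rule ccontr)
    fix a b assume "a \<in> A" "b \<in> A" "?f a = ?f b" "a \<noteq> b"
    then show False using less[of a b] less[of b a] total[of a b] by auto
  qed
  moreover have "?f ` A \<subseteq> {1..card A}"
    using assms irrefl by (fastforce simp: Suc_le_eq card_gt_0_iff intro: card_mono)
  ultimately have "?f ` A = {1..card A}"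
    by (intro card_subset_eq) (simp_all add: card_image)
  with inj show ?thesis by (simp add: bij_betw_def)
qed

lemma finite_extensions: "finite {v. length v = m \<and> good (w @ v)}"
proof -
  have "(@) w ` {v. length v = m \<and> good (w @ v)} \<subseteq> {u. rgf u \<and> length u = length w + m}"
    by (auto simp: good_def)
  then have "finite ((@) w ` {v. length v = m \<and> good (w @ v)})"
    using finite_rgf by (rule finite_subset)
  then show ?thesis by (rule finite_imageD) (simp add: inj_on_def)
qed

text \<open>Split by the first appended letter. From label h, the new letter leads to h + 1, the
  maximum to h, and the active letters, according to their ranks, to 1, ..., h.\<close>

lemma card_extensions:
  "good w \<Longrightarrow> w \<noteq> [] \<Longrightarrow> card {v. length v = m \<and> good (w @ v)} = walks m (card (active w))"
proof (induction m arbitrary: w)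
  case 0
  then have "{v. length v = 0 \<and> good (w @ v)} = {[]}" by auto
  then show ?case by simp
next
  case (Suc m)
  define E where "E = (\<lambda>u. {v. length v = m \<and> good (u @ v)})"
  let ?k = "card (set w)"
  let ?N = "insert (Suc ?k) (insert ?k (active w))"
  have w: "rgf w" using Suc.prems by (simp add: good_def)
  note snoc = good_snoc[OF Suc.prems]
  have IH: "card (E (w @ [a])) = walks m (card (active (w @ [a])))" if "a \<in> ?N" for a
    unfolding E_def using Suc.IH[of "w @ [a]"] that snoc by simp
  have "{v. length v = Suc m \<and> good (w @ v)} = (\<Union>a\<in>?N. (#) a ` E (w @ [a]))"
  proof (intro equalityI subsetI)
    fix v assume "v \<in> {v. length v = Suc m \<and> good (w @ v)}"
    then obtain a v' where v: "v = a # v'" "length v' = m" "good ((w @ [a]) @ v')"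
      by (auto simp: length_Suc_conv)
    then show "v \<in> (\<Union>a\<in>?N. (#) a ` E (w @ [a]))"
      using snoc good_append[OF v(3)] by (auto simp: E_def)
  qed (auto simp: E_def)
  moreover have "finite (E u)" for u unfolding E_def by (rule finite_extensions)
  then have "card (\<Union>a\<in>?N. (#) a ` E (w @ [a])) = (\<Sum>a\<in>?N. card ((#) a ` E (w @ [a])))"
    by (intro card_UN_disjoint) (auto simp: finite_active)
  moreover have "\<dots> = (\<Sum>a\<in>?N. walks m (card (active (w @ [a]))))"
    by (intro sum.cong refl) (simp only: IH card_image[OF inj_on_Cons1])
  moreover have "?k \<notin> active w" "Suc ?k \<notin> active w" by (auto simp: active_def)
  moreover have "(\<Sum>a\<in>active w. walks m (card (active (w @ [a])))) =
      (\<Sum>j=1..card (active w). walks m j)"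
  proof -
    have "(\<Sum>a\<in>active w. walks m (card (active (w @ [a])))) =
        (\<Sum>a\<in>active w. walks m (card {x \<in> active w. \<not> R a x}))"
      by (intro sum.cong refl) (simp add: active_snoc_active[OF w])
    also have "\<dots> = (\<Sum>j=1..card (active w). walks m j)"
      by (intro sum.reindex_bij_betw bij_betw_card_below finite_active)
    finally show ?thesis .
  qed
  ultimately show ?case
    using Suc.prems(2) w
    by (simp add: finite_active active_snoc_max active_snoc_new)
qed

text \<open>The root of the tree is \<open>[1]\<close>, the only good word of length 1; it has no
  active letter.\<close>

lemma card_good_Suc: "card {w. good w \<and> length w = Suc m} = walks m 0"
proof -
  have one: "good [1]"
    using rgf_snoc[of "[]" 1] by (auto simp: good_def rgf_Nil)
  have hd: "a = 1" if "good (a # w)" for a w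
    using good_append[of "[a]" w] rgf_snoc[of "[]" a] that by (simp add: good_def)
  have "{w. good w \<and> length w = Suc m} = (#) 1 ` {v. length v = m \<and> good ([1] @ v)}"
    using hd by (auto simp: length_Suc_conv image_iff)
  then have "card {w. good w \<and> length w = Suc m} = card {v. length v = m \<and> good ([1] @ v)}"
    by (simp add: card_image)
  also have "\<dots> = walks m (card (active [1]))" by (intro card_extensions one) simp
  also have "active [1] = {}" by (auto simp: active_def)
  finally show ?thesis by simp
qed

subsection \<open>Direct sums\<close>

definition irreducible_good :: "nat list set" where
  "irreducible_good = {w. good w \<and> w \<noteq> [] \<and> irreducible_word w}"

text \<open>In an occurrence \<open>c x y\<close> the letter \<open>c\<close> is the largest. If
  \<open>c\<close> came from \<open>u\<close> and \<open>y\<close> from the shifted part, then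
  \<open>y\<close> would be larger, so every occurrence lies within one summand.\<close>

lemma good_direct_sum:
  assumes u: "rgf u" and v: "rgf v"
  shows "good (direct_sum (u, v)) \<longleftrightarrow> good u \<and> good v"
proof -
  let ?k = "card (set u)"
  let ?v = "map ((+) ?k) v"
  let ?bad = "\<lambda>w. \<exists>c x y. x < c \<and> y < c \<and> R x y \<and> subseq [c, x, y] w"
  have w: "rgf (u @ ?v)" using rgf_sum[OF u] v rgf_positive by blast
  have "?bad (u @ ?v) \<longleftrightarrow> ?bad u \<or> ?bad v"
  proof
    assume "?bad (u @ ?v)"
    then obtain c x y xs1 xs2 where cxy: "x < c" "y < c" "R x y"
      and xs: "[c, x, y] = xs1 @ xs2" "subseq xs1 u" "subseq xs2 ?v"
      unfolding subseq_append_iff by blast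
    consider "xs1 = []" | "xs2 = []" | "xs1 \<noteq> []" "xs2 \<noteq> []" by blast
    then show "?bad u \<or> ?bad v"
    proof cases
      case 1
      then have sub: "subseq [c, x, y] ?v" using xs by simp
      then have "c \<in> set ?v" "x \<in> set ?v" "y \<in> set ?v"
        using subseq_set[OF sub] by auto
      then obtain c' x' y' where eq: "c = ?k + c'" "x = ?k + x'" "y = ?k + y'" by auto
      have "subseq [c', x', y'] v"
        using subseq_map[OF sub, of "\<lambda>a. a - ?k"] by (simp add: eq comp_def)
      then show ?thesis using cxy eq shift by auto
    next
      case 2
      then show ?thesis using xs cxy by auto
    next
      case 3
      then have "c \<in> set xs1" "y \<in> set xs2"
        using xs(1) by (auto simp: Cons_eq_append_conv)
      then have "c \<in> set u" "y \<in> set ?v"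
        using subseq_set[OF xs(2)] subseq_set[OF xs(3)] by auto
      then show ?thesis using cxy rgf_mem_iff[OF u] by auto
    qed
  next
    assume "?bad u \<or> ?bad v"
    then show "?bad (u @ ?v)"
    proof
      assume "?bad v"
      then obtain c x y where cxy: "x < c" "y < c" "R x y" "subseq [c, x, y] v" by blast
      then have "subseq [?k + c, ?k + x, ?k + y] (u @ ?v)"
        using subseq_map[of "[c, x, y]" v "(+) ?k"] by (auto intro: subseq_drop_many)
      then show ?thesis using cxy shift by (meson nat_add_left_cancel_less)
    qed (blast intro: subseq_rev_drop_many)
  qed
  then show ?thesis using u v w by (simp add: good_def direct_sum_def)
qed

text \<open>If the first summands had different lengths, the end of the shorter would be a cut of
  the longer, contradicting irreducibility.\<close>

lemma direct_sum_eq: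
  assumes "u \<in> irreducible_good" "u' \<in> irreducible_good" "good v" "good v'"
    and eq: "direct_sum (u, v) = direct_sum (u', v')"
  shows "u = u' \<and> v = v'"
proof -
  have False if "u \<in> irreducible_good" "u' \<in> irreducible_good" "good v" "length u < length u'"
    and eq: "direct_sum (u, v) = direct_sum (u', v')" for u u' v v'
  proof -
    let ?v = "map ((+) (card (set u))) v"
    have rgf: "rgf u" "rgf v" "u \<noteq> []"
      using that by (auto simp: irreducible_good_def good_def)
    from eq have eq': "u @ ?v = u' @ map ((+) (card (set u'))) v'" by (simp add: direct_sum_def)
    have "take (length u) u' = u" "set (drop (length u) u') \<subseteq> set ?v"
      using arg_cong[OF eq', of "take (length u)"] arg_cong[OF eq', of "drop (length u)"] that(4)
      by auto
    moreover have "set u \<inter> set ?v = {}"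
      using rgf_mem_iff[OF rgf(1)] rgf_mem_iff[OF rgf(2)] by auto
    ultimately have "set (take (length u) u') \<inter> set (drop (length u) u') = {}" by auto
    moreover have "length u \<in> {1..<length u'}" using that(4) rgf(3) by (auto simp: Suc_le_eq)
    moreover have "irreducible_word u'" using that(2) by (simp add: irreducible_good_def)
    ultimately show False unfolding irreducible_word_def by blast
  qed
  then have "length u = length u'" using assms by (metis nat_neq_iff)
  then have "u = u'" "map ((+) (card (set u))) v = map ((+) (card (set u'))) v'"
    using eq by (auto simp: direct_sum_def)
  then show ?thesis by (auto simp: inj_map_eq_map)
qed

text \<open>Cut at the first position where no letter occurs on both sides. An earlier cut of the
  resulting prefix would also be a cut of \<open>w\<close>, so the prefix is irreducible.\<close>

lemma good_decompose:
  assumes w: "good w" "w \<noteq> []"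
  shows "w \<in> direct_sum ` (irreducible_good \<times> {v. good v})"
proof -
  let ?P = "\<lambda>r. 1 \<le> r \<and> r \<le> length w \<and> set (take r w) \<inter> set (drop r w) = {}"
  define r where "r = (LEAST r. ?P r)"
  have "?P (length w)" using w by (simp add: Suc_le_eq)
  then have r: "?P r" unfolding r_def by (rule LeastI)
  have least: "\<not> ?P i" if "i < r" for i using not_less_Least[OF that[unfolded r_def]] .
  define u where "u = take r w"
  have u: "rgf u" using w(1) rgf_append[of u "drop r w"] by (simp add: u_def good_def)
  have "rgf (u @ drop r w)" using w(1) by (simp add: u_def good_def)
  then obtain v where v: "drop r w = map ((+) (card (set u))) v" "rgf v"
    using rgf_tail r unfolding u_def by blast
  have w_eq: "w = direct_sum (u, v)"
    using append_take_drop_id[of r w] v(1) by (simp add: direct_sum_def u_def)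
  then have good: "good u" "good v" using good_direct_sum[OF u v(2)] w(1) by auto
  have "irreducible_word u"
    unfolding irreducible_word_def
  proof
    fix i assume i: "i \<in> {1..<length u}"
    then have ir: "1 \<le> i" "i < r" by (auto simp: u_def)
    then obtain a where a: "a \<in> set (take i w)" "a \<in> set (drop i w)"
      using least[of i] r by auto
    have "drop i w = drop i u @ drop r w"
      using append_take_drop_id[of r w] drop_append[of i u "drop r w"] ir r by (simp add: u_def)
    moreover have ti: "take i u = take i w" using ir by (simp add: u_def min_def)
    moreover have "a \<notin> set (drop r w)"
      using a(1) r ti set_take_subset[of i u] unfolding u_def by auto
    ultimately show "set (take i u) \<inter> set (drop i u) \<noteq> {}" using a by auto
  qed
  then have "u \<in> irreducible_good" using good r w by (auto simp: irreducible_good_def u_def)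
  then show ?thesis using w_eq good(2) by blast
qed

lemma finite_good: "A \<subseteq> {w. good w} \<Longrightarrow> finite {w \<in> A. length w = n}"
  by (rule finite_subset[OF _ finite_rgf[of n]]) (auto simp: good_def)

lemma good_Nil: "good []"
  by (simp add: good_def rgf_Nil)

lemma gf_good:
  defines "G \<equiv> gf length {w. good w}"
  shows "G = 1 + gf length irreducible_good * G"
proof -
  let ?D = "direct_sum ` (irreducible_good \<times> {v. good v})"
  have rgf: "rgf w" if "good w" for w using that by (simp add: good_def)
  have sub: "?D \<subseteq> {w. good w}" "irreducible_good \<subseteq> {w. good w}"
    by (auto simp: irreducible_good_def good_direct_sum rgf)
  have ne: "[] \<notin> ?D" by (auto simp: irreducible_good_def direct_sum_def)
  have "{w. good w} = {[]} \<union> ?D" using sub(1) good_Nil good_decompose by blast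
  then have "G = gf length ({[]} \<union> ?D)" unfolding G_def by (rule arg_cong)
  also have "\<dots> = gf length {[] :: nat list} + gf length ?D"
    using sub ne by (intro gf_Un finite_good) (auto simp: good_Nil)
  also have "gf length {[] :: nat list} = 1" by (rule gf_singleton) simp
  also have "gf length ?D = fps_X ^ 0 * gf length irreducible_good * G"
    unfolding G_def
  proof (intro gf_product finite_good)
    show "inj_on direct_sum (irreducible_good \<times> {v. good v})"
      by (rule inj_onI) (auto dest: direct_sum_eq)
  qed (use sub in \<open>auto simp: direct_sum_def\<close>)
  finally show ?thesis by simp
qed


lemma gf_good_walks: "gf length {w. good w} = 1 + fps_X * walk_series 0"
proof (rule fps_ext)
  fix n
  have "{w. good w \<and> w = []} = {[]}" using good_Nil by auto
  then show "gf length {w. good w} $ n = (1 + fps_X * walk_series 0) $ n"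
    by (cases n) (simp_all add: gf_nth walk_series_def card_good_Suc)
qed

text \<open>The two equations for G give I G = X W, and multiplying the first by 1 - X - X S turns
  it into G (1 - X - X S) = 1 - X S. Together they yield I (1 - X S) = X, and F is the inverse of 1
  - X S.\<close>

lemma gf_irreducible_good:
  fixes S F :: "rat fps"
  assumes S: "S = 1 + fps_X * S * S + fps_X * (S - 1)" and F: "F = 1 + fps_X * S * F"
  shows "gf length irreducible_good = fps_X * F"
proof -
  define I G W where "I = gf length irreducible_good" and "G = gf length {w. good w}"
    and "W = walk_series 0"
  have G: "G = 1 + fps_X * W" "G = 1 + I * G"
    unfolding I_def G_def W_def using gf_good gf_good_walks by auto
  have W: "W * (1 - fps_X - fps_X * S) = 1" unfolding W_def using S by (rule walk_series_power)
  have "G * (1 - fps_X - fps_X * S) = (1 - fps_X - fps_X * S) + fps_X * (W * (1 - fps_X - fps_X * S))"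
    by (subst G(1)) (simp only: distrib_right mult_1_left mult.assoc)
  then have "1 - fps_X * S = G * (1 - fps_X - fps_X * S)" unfolding W by simp
  then have "I * (1 - fps_X * S) = (I * G) * (1 - fps_X - fps_X * S)" by (simp only: mult.assoc)
  also have "I * G = fps_X * W" using G by (metis add_left_cancel)
  also have "fps_X * W * (1 - fps_X - fps_X * S) = fps_X" by (simp only: mult.assoc W mult_1_right)
  finally have "I * (1 - fps_X * S) * F = fps_X * F" by simp
  moreover have "(1 - fps_X * S) * F = 1"
  proof -
    have "(1 - fps_X * S) * F = F - fps_X * S * F" by (simp add: algebra_simps)
    also have "\<dots> = 1" by (subst (1) F) simp
    finally show ?thesis .
  qed
  ultimately show ?thesis by (simp add: I_def mult.assoc)
qed

end

subsection \<open>Canonical words of partitions\<close>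

lemma initial_segment:
  fixes A :: "nat set"
  assumes "finite A" "0 \<notin> A" and down: "\<And>i j. j \<in> A \<Longrightarrow> 1 \<le> i \<Longrightarrow> i < j \<Longrightarrow> i \<in> A"
  shows "A = {1..card A}"
proof (cases "A = {}")
  case False
  have "A = {1..Max A}"
  proof (intro equalityI subsetI)
    fix i assume "i \<in> A"
    then show "i \<in> {1..Max A}" using assms(1,2) by (cases i) auto
  next
    fix i assume "i \<in> {1..Max A}"
    then show "i \<in> A" using down[of "Max A" i] Max_in[OF assms(1) False] by (cases "i = Max A") auto
  qed
  then show ?thesis by (metis card_atLeastAtMost diff_Suc_1)
qed simp

text \<open>Positions count from 1, as the elements of the partitioned set do, while list indices
  start at 0.\<close>

definition letter_block :: "nat list \<Rightarrow> nat \<Rightarrow> nat set" where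
  "letter_block w j = {i \<in> {1..length w}. w ! (i - 1) = j}"

definition word_partition :: "nat list \<Rightarrow> nat set set" where
  "word_partition w = letter_block w ` set w"

lemma length_canonical_word: "length (canonical_word m P) = m"
  by (simp add: canonical_word_def del: upt_Suc)

context
  fixes m :: nat and P :: "nat set set"
  assumes P: "partition_on {1..m} P"
begin

private abbreviation (input) blocks where "blocks \<equiv> canonical_blocks P"
private abbreviation (input) word where "word \<equiv> canonical_word m P"

lemma canonical_block_ex:
  assumes "i \<in> {1..m}"
  shows "\<exists>j\<in>{1..length blocks}. i \<in> blocks ! (j - 1)"
proof -
  obtain B where "B \<in> P" "i \<in> B" using P assms by (metis UnionE partition_onD1)
  then obtain l where "l < length blocks" "i \<in> blocks ! l"
    using canonical_blocks_spec(1)[OF P] by (metis in_set_conv_nth)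
  then show ?thesis by (intro bexI[of _ "Suc l"]) auto
qed

lemma canonical_block_mem: "j \<in> {1..length blocks} \<Longrightarrow> blocks ! (j - 1) \<in> P"
  using canonical_blocks_spec(1)[OF P] by (metis One_nat_def Suc_le_eq Suc_pred' atLeastAtMost_iff nth_mem)

lemma canonical_block_eq:
  assumes j: "j \<in> {1..length blocks}"
  shows "blocks ! (j - 1) = letter_block word j"
proof -
  have "blocks ! (j - 1) \<subseteq> {1..m}" using P canonical_block_mem[OF j] by (auto simp: partition_on_def)
  then show ?thesis
    using canonical_word_nth_iff[OF P _ j] unfolding letter_block_def length_canonical_word by blast
qed

lemma canonical_block_Min:
  assumes j: "j \<in> {1..length blocks}"
  shows "Min (blocks ! (j - 1)) \<in> blocks ! (j - 1)"
proof -
  have "blocks ! (j - 1) \<noteq> {}" using P canonical_block_mem[OF j] by (auto simp: partition_on_def)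
  moreover have "finite (blocks ! (j - 1))" unfolding canonical_block_eq[OF j] letter_block_def by simp
  ultimately show ?thesis by (intro Min_in)
qed

lemma canonical_word_letters: "set word = {1..length blocks}"
proof (intro equalityI subsetI)
  fix j assume "j \<in> set word"
  then obtain l where l: "l < m" "word ! l = j" by (auto simp: in_set_conv_nth length_canonical_word)
  then obtain j' where j': "j' \<in> {1..length blocks}" "Suc l \<in> blocks ! (j' - 1)"
    using canonical_block_ex[of "Suc l"] by auto
  then have "word ! l = j'" using canonical_word_nth_iff[OF P _ j'(1), of "Suc l"] l by simp
  then show "j \<in> {1..length blocks}" using l j' by simp
next
  fix j assume j: "j \<in> {1..length blocks}"
  have "Min (blocks ! (j - 1)) \<in> letter_block word j"
    using canonical_block_Min[OF j] unfolding canonical_block_eq[OF j] .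
  then have "Min (blocks ! (j - 1)) - 1 < length word" "word ! (Min (blocks ! (j - 1)) - 1) = j"
    by (auto simp: letter_block_def)
  then show "j \<in> set word" by (metis nth_mem)
qed

lemma word_partition_canonical_word: "word_partition word = P"
proof -
  have "P = set blocks" using canonical_blocks_spec(1)[OF P] by simp
  also have "\<dots> = (\<lambda>j. blocks ! (j - 1)) ` {1..length blocks}"
  proof (intro equalityI subsetI)
    fix B assume "B \<in> set blocks"
    then obtain l where "l < length blocks" "blocks ! l = B" by (auto simp: in_set_conv_nth)
    then show "B \<in> (\<lambda>j. blocks ! (j - 1)) ` {1..length blocks}"
      by (intro image_eqI[of _ _ "Suc l"]) auto
  qed auto
  also have "\<dots> = letter_block word ` {1..length blocks}"
    by (intro image_cong refl canonical_block_eq)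
  finally show ?thesis by (simp add: word_partition_def canonical_word_letters)
qed

text \<open>The letter j first occurs at the minimum of the j-th block. Since the minima increase,
  any prefix containing j contains all smaller letters.\<close>

lemma rgf_canonical_word: "rgf word"
  unfolding rgf_def
proof (intro allI impI)
  fix u assume u: "prefix u word"
  then have sub: "set u \<subseteq> {1..length blocks}"
    using set_mono_prefix[OF u] canonical_word_letters by simp
  show "set u = {1..card (set u)}"
  proof (rule initial_segment)
    show "0 \<notin> set u" using sub by auto
    fix i j assume j: "j \<in> set u" and i: "1 \<le> i" "i < j"
    have ij: "i \<in> {1..length blocks}" "j \<in> {1..length blocks}" using i j sub by auto
    obtain l where l: "l < length u" "u ! l = j" using j by (auto simp: in_set_conv_nth)
    then have "Suc l \<in> letter_block word j"
      using u by (auto simp: letter_block_def prefix_def nth_append)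
    then have "Min (blocks ! (j - 1)) \<le> Suc l"
      unfolding canonical_block_eq[OF ij(2)] by (intro Min_le) (simp_all add: letter_block_def)
    moreover have "Min (blocks ! (i - 1)) < Min (blocks ! (j - 1))"
      using canonical_blocks_spec(2)[OF P] i ij by (intro sorted_wrt_nth_less[of "\<lambda>B C. Min B < Min C"]) auto
    ultimately have lt: "Min (blocks ! (i - 1)) - 1 < length u" using l by simp
    have "word ! (Min (blocks ! (i - 1)) - 1) = i"
      using canonical_block_Min[OF ij(1)] unfolding canonical_block_eq[OF ij(1)]
      by (auto simp: letter_block_def)
    then have "u ! (Min (blocks ! (i - 1)) - 1) = i"
      using u lt by (auto simp: prefix_def nth_append)
    then show "i \<in> set u" using lt by (metis nth_mem)
  qed simp
qed

text \<open>A block lies on one side of the cut exactly if its letter is absent from the other part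
  of the word.\<close>

lemma irreducible_partition_iff: "irreducible_partition m P \<longleftrightarrow> irreducible_word word"
proof -
  have cut: "(\<forall>B\<in>P. B \<subseteq> {1..r} \<or> B \<subseteq> {r + 1..m}) \<longleftrightarrow> set (take r word) \<inter> set (drop r word) = {}"
    if "r \<in> {1..m - 1}" for r
  proof -
    have "(\<forall>B\<in>P. B \<subseteq> {1..r} \<or> B \<subseteq> {r + 1..m}) \<longleftrightarrow>
        (\<forall>j\<in>set word. letter_block word j \<subseteq> {1..r} \<or> letter_block word j \<subseteq> {r + 1..m})"
      by (subst word_partition_canonical_word[symmetric]) (simp add: word_partition_def)
    also have "\<dots> \<longleftrightarrow> (\<forall>j\<in>set word. j \<notin> set (drop r word) \<or> j \<notin> set (take r word))"
    proof (intro ball_cong refl arg_cong2[of _ _ _ _ "(\<or>)"])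
      fix j
      have w: "length word = m" by (rule length_canonical_word)
      show "letter_block word j \<subseteq> {1..r} \<longleftrightarrow> j \<notin> set (drop r word)"
      proof
        assume sub: "letter_block word j \<subseteq> {1..r}"
        show "j \<notin> set (drop r word)"
        proof
          assume "j \<in> set (drop r word)"
          then obtain l where "l < m - r" "word ! (r + l) = j"
            using that by (auto simp: in_set_conv_nth w)
          then have "Suc (r + l) \<in> letter_block word j" by (auto simp: letter_block_def w)
          then show False using sub by auto
        qed
      next
        assume j: "j \<notin> set (drop r word)"
        show "letter_block word j \<subseteq> {1..r}"
        proof
          fix i assume i: "i \<in> letter_block word j"
          have "\<not> r < i"
          proof
            assume "r < i"
            then have "drop r word ! (i - 1 - r) = j" "i - 1 - r < length (drop r word)"
              using i by (auto simp: letter_block_def w)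
            then show False using j by (metis nth_mem)
          qed
          then show "i \<in> {1..r}" using i by (auto simp: letter_block_def)
        qed
      qed
      show "letter_block word j \<subseteq> {r + 1..m} \<longleftrightarrow> j \<notin> set (take r word)"
      proof
        assume sub: "letter_block word j \<subseteq> {r + 1..m}"
        show "j \<notin> set (take r word)"
        proof
          assume "j \<in> set (take r word)"
          then obtain l where "l < r" "l < m" "word ! l = j"
            by (auto simp: in_set_conv_nth w)
          then have "Suc l \<in> letter_block word j" by (simp add: letter_block_def w)
          then show False using sub \<open>l < r\<close> by auto
        qed
      next
        assume j: "j \<notin> set (take r word)"
        show "letter_block word j \<subseteq> {r + 1..m}"
        proof
          fix i assume i: "i \<in> letter_block word j"
          have "\<not> i \<le> r"
          proof
            assume "i \<le> r"
            then have "take r word ! (i - 1) = j" "i - 1 < length (take r word)"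
              using i by (auto simp: letter_block_def w)
            then show False using j by (metis nth_mem)
          qed
          then show "i \<in> {r + 1..m}" using i by (auto simp: letter_block_def w)
        qed
      qed
    qed
    also have "\<dots> \<longleftrightarrow> set (take r word) \<inter> set (drop r word) = {}"
      by (auto dest: in_set_takeD)
    finally show ?thesis .
  qed
  have "(\<exists>r\<in>{1..m - 1}. \<forall>B\<in>P. B \<subseteq> {1..r} \<or> B \<subseteq> {r + 1..m}) \<longleftrightarrow>
      (\<exists>r\<in>{1..m - 1}. set (take r word) \<inter> set (drop r word) = {})"
    by (intro bex_cong refl cut)
  moreover have "{1..m - 1} = {1..<length word}" by (auto simp: length_canonical_word)
  ultimately show ?thesis using P unfolding irreducible_partition_def irreducible_word_def by metis
qed

end

text \<open>By restricted growth, first occurrences increase with the letter, so listing the blocks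
  by letter is listing them by minimum.\<close>

lemma canonical_word_word_partition:
  assumes w: "rgf w"
  shows "partition_on {1..length w} (word_partition w)"
    and "canonical_word (length w) (word_partition w) = w"
proof -
  let ?P = "word_partition w" and ?k = "card (set w)"
  let ?Bs = "map (letter_block w) [1..<Suc ?k]"
  show part: "partition_on {1..length w} ?P"
  proof (rule partition_onI)
    show "\<Union>?P = {1..length w}"
      by (auto simp: word_partition_def letter_block_def)
    show "disjnt p q" if "p \<in> ?P" "q \<in> ?P" "p \<noteq> q" for p q
      using that by (auto simp: word_partition_def letter_block_def disjnt_def)
    show "{} \<notin> ?P"
    proof
      assume "{} \<in> ?P"
      then obtain l where "l < length w" "letter_block w (w ! l) = {}"
        unfolding word_partition_def in_set_conv_nth by (metis imageE in_set_conv_nth)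
      moreover from this have "Suc l \<in> letter_block w (w ! l)" by (simp add: letter_block_def)
      ultimately show False by simp
    qed
  qed
  have fin: "finite (letter_block w j)" for j by (simp add: letter_block_def)
  have Min: "Min (letter_block w j) \<in> letter_block w j" if "j \<in> set w" for j
    using that partition_onD3[OF part] by (intro Min_in fin) (auto simp: word_partition_def)
  have set_Bs: "set ?Bs = ?P"
    unfolding word_partition_def set_map set_upt atLeastLessThanSuc_atLeastAtMost
    by (simp only: rgf_set[OF w, symmetric])
  have less: "Min (letter_block w i) < Min (letter_block w j)" if "1 \<le> i" "i < j" "j \<le> ?k" for i j
  proof -
    define l where "l = Min (letter_block w j)"
    have "j \<in> set w" using that rgf_mem_iff[OF w] by auto
    then have l: "1 \<le> l" "l \<le> length w" "w ! (l - 1) = j"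
      using Min[of j] by (auto simp: l_def letter_block_def)
    then have "j \<in> set (take l w)"
      by (auto simp: in_set_conv_nth intro!: exI[of _ "l - 1"])
    moreover have rgf: "rgf (take l w)" using w rgf_append[of "take l w" "drop l w"] by simp
    ultimately have "i \<in> set (take l w)" using rgf_mem_iff[OF rgf] that by auto
    then obtain n where n: "n < l" "n < length w" "w ! n = i" by (auto simp: in_set_conv_nth)
    then have "Suc n \<in> letter_block w i" by (simp add: letter_block_def)
    then have "Min (letter_block w i) \<le> Suc n" using fin by simp
    moreover have "Suc n \<noteq> l" using n l that by auto
    ultimately show ?thesis using n by (simp add: l_def)
  qed
  have blocks: "canonical_blocks ?P = ?Bs"
  proof -
    note spec = canonical_blocks_spec[OF part]
    have sorted: "sorted_wrt (<) (map Min (canonical_blocks ?P))"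
      using spec(2) by (simp add: sorted_wrt_map)
    have sorted': "sorted_wrt (<) (map Min ?Bs)"
      unfolding map_map sorted_wrt_map
      by (rule sorted_wrt_mono_rel[OF _ sorted_wrt_upt]) (auto intro: less simp del: upt_Suc)
    \<comment> \<open>A strictly sorted list is determined by its set, and \<open>Min\<close> is
      injective on the blocks, so equal minima give equal lists of blocks.\<close>
    have eq: "map Min (canonical_blocks ?P) = map Min ?Bs"
      using sorted sorted' by (intro strict_sorted_equal) (simp_all only: set_map[of Min] spec(1) set_Bs)
    have "inj_on Min (set (canonical_blocks ?P) \<union> set ?Bs)"
    proof -
      have "distinct (map Min (canonical_blocks ?P))" using sorted strict_sorted_iff by blast
      then show ?thesis unfolding set_Bs spec(1) distinct_map by simp
    qed
    then show ?thesis using eq by (rule map_inj_on[rotated])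
  qed
  show "canonical_word (length w) ?P = w"
  proof (rule nth_equalityI)
    fix l assume "l < length (canonical_word (length w) ?P)"
    then have l: "l < length w" by (simp add: length_canonical_word)
    have "1 \<le> w ! l" "w ! l \<le> ?k" using rgf_mem_iff[OF w, of "w ! l"] l by auto
    then have "canonical_blocks ?P ! (w ! l - 1) = letter_block w (w ! l)"
      "w ! l \<in> {1..length (canonical_blocks ?P)}"
      unfolding blocks by (simp_all del: upt_Suc)
    then show "canonical_word (length w) ?P ! l = w ! l"
      using canonical_word_nth_iff[OF part, of "Suc l" "w ! l"] l by (simp add: letter_block_def)
  qed (simp add: length_canonical_word)
qed

lemma bij_betw_canonical_word:
  "bij_betw (canonical_word m) {P. partition_on {1..m} P} {w. rgf w \<and> length w = m}"
proof (rule bij_betw_byWitness[where f' = word_partition])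
  show "\<forall>P\<in>{P. partition_on {1..m} P}. word_partition (canonical_word m P) = P"
    by (simp add: word_partition_canonical_word)
qed (use canonical_word_word_partition rgf_canonical_word length_canonical_word in auto)

section \<open>The two patterns in restricted growth functions\<close>

lemma order_isomorphic_12312:
  "order_isomorphic s [1, 2, 3, 1, 2] \<longleftrightarrow> (\<exists>x y c. x < y \<and> y < c \<and> s = [x, y, c, x, y])"
proof
  assume s: "order_isomorphic s [1, 2, 3, 1, 2]"
  then have "length s = 5" by (simp add: order_isomorphic_def)
  then obtain a b c d e where eq: "s = [a, b, c, d, e]"
    by (auto simp: eval_nat_numeral length_Suc_conv)
  \<comment> \<open>Equal letters of the pattern force equal letters of \<open>s\<close>, as neither
    may be smaller than the other.\<close>
  have "\<not> a < d" "\<not> d < a" "\<not> b < e" "\<not> e < b" "a < b" "b < c"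
    using s unfolding eq order_isomorphic_def by (auto simp: All_less_Suc eval_nat_numeral)
  then show "\<exists>x y c. x < y \<and> y < c \<and> s = [x, y, c, x, y]" using eq by auto
next
  assume "\<exists>x y c. x < y \<and> y < c \<and> s = [x, y, c, x, y]"
  then obtain x y c where "x < y" "y < c" and s: "s = [x, y, c, x, y]" by blast
  then show "order_isomorphic s [1, 2, 3, 1, 2]"
    unfolding s order_isomorphic_def by (simp add: All_less_Suc eval_nat_numeral)
qed

lemma order_isomorphic_12321:
  "order_isomorphic s [1, 2, 3, 2, 1] \<longleftrightarrow> (\<exists>x y c. x < y \<and> y < c \<and> s = [x, y, c, y, x])"
proof
  assume s: "order_isomorphic s [1, 2, 3, 2, 1]"
  then have "length s = 5" by (simp add: order_isomorphic_def)
  then obtain a b c d e where eq: "s = [a, b, c, d, e]"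
    by (auto simp: eval_nat_numeral length_Suc_conv)
  have "\<not> a < e" "\<not> e < a" "\<not> b < d" "\<not> d < b" "a < b" "b < c"
    using s unfolding eq order_isomorphic_def by (auto simp: All_less_Suc eval_nat_numeral)
  then show "\<exists>x y c. x < y \<and> y < c \<and> s = [x, y, c, y, x]" using eq by auto
next
  assume "\<exists>x y c. x < y \<and> y < c \<and> s = [x, y, c, y, x]"
  then obtain x y c where "x < y" "y < c" and s: "s = [x, y, c, y, x]" by blast
  then show "order_isomorphic s [1, 2, 3, 2, 1]"
    unfolding s order_isomorphic_def by (simp add: All_less_Suc eval_nat_numeral)
qed

text \<open>Before any occurrence of \<open>c\<close>, all smaller positive letters have appeared,
  with their first occurrences in increasing order; these supply \<open>x\<close> and
  \<open>y\<close>.\<close>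

lemma rgf_subseq_extend:
  assumes w: "rgf w" and sub: "subseq (c # v) w" and x: "1 \<le> x" "x < y" "y < c"
  shows "subseq (x # y # c # v) w"
proof -
  from sub obtain w1 w2 where eq: "w = w1 @ c # w2" and v: "subseq v w2"
    by (auto dest: list_emb_ConsD)
  have "rgf ((w1 @ [c]) @ w2)" using w eq by simp
  then have "rgf (w1 @ [c])" by (rule rgf_append)
  then have w1: "rgf w1" "c \<le> Suc (card (set w1))" by (simp_all add: rgf_snoc)
  have "subseq [x, y] [1..<Suc (card (set w1))]"
    using x w1(2) by (intro sorted_subset_imp_subseq) (auto simp del: upt_Suc)
  then have "subseq [x, y] w1" using rgf_subseq_upt[OF w1(1)] by (rule subseq_order.order_trans)
  then have "subseq ([x, y] @ (c # v)) (w1 @ (c # w2))"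
    using v by (intro list_emb_append_mono) auto
  then show ?thesis using eq by simp
qed

lemma word_avoids_12312:
  assumes w: "rgf w"
  shows "word_avoids w [1, 2, 3, 1, 2] \<longleftrightarrow>
    \<not> (\<exists>c x y. x < c \<and> y < c \<and> x < y \<and> subseq [c, x, y] w)"
proof -
  have iff: "subseq [x, y, c, x, y] w \<longleftrightarrow> subseq [c, x, y] w" if "x < y" "y < c" for x y c
  proof
    assume sub: "subseq [c, x, y] w"
    then have "1 \<le> x" using subseq_set[OF sub] rgf_mem_iff[OF w] by auto
    then show "subseq [x, y, c, x, y] w" using that by (intro rgf_subseq_extend[OF w sub])
  qed (blast dest: subseq_Cons')
  have "(\<exists>s. subseq s w \<and> order_isomorphic s [1, 2, 3, 1, 2]) \<longleftrightarrow>
      (\<exists>x y c. x < y \<and> y < c \<and> subseq [x, y, c, x, y] w)"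
    unfolding order_isomorphic_12312 by blast
  also have "\<dots> \<longleftrightarrow> (\<exists>x y c. x < y \<and> y < c \<and> subseq [c, x, y] w)"
    by (intro ex_cong1 conj_cong refl iff)
  also have "\<dots> \<longleftrightarrow> (\<exists>c x y. x < c \<and> y < c \<and> x < y \<and> subseq [c, x, y] w)"
    by (meson less_trans)
  finally show ?thesis by (simp only: word_avoids_def)
qed

lemma word_avoids_12321:
  assumes w: "rgf w"
  shows "word_avoids w [1, 2, 3, 2, 1] \<longleftrightarrow>
    \<not> (\<exists>c x y. x < c \<and> y < c \<and> x > y \<and> subseq [c, x, y] w)"
proof -
  have iff: "subseq [x, y, c, y, x] w \<longleftrightarrow> subseq [c, y, x] w" if "x < y" "y < c" for x y c
  proof
    assume sub: "subseq [c, y, x] w"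
    then have "1 \<le> x" using subseq_set[OF sub] rgf_mem_iff[OF w] by auto
    then show "subseq [x, y, c, y, x] w" using that by (intro rgf_subseq_extend[OF w sub])
  qed (blast dest: subseq_Cons')
  have "(\<exists>s. subseq s w \<and> order_isomorphic s [1, 2, 3, 2, 1]) \<longleftrightarrow>
      (\<exists>x y c. x < y \<and> y < c \<and> subseq [x, y, c, y, x] w)"
    unfolding order_isomorphic_12321 by blast
  also have "\<dots> \<longleftrightarrow> (\<exists>x y c. x < y \<and> y < c \<and> subseq [c, y, x] w)"
    by (intro ex_cong1 conj_cong refl iff)
  also have "\<dots> \<longleftrightarrow> (\<exists>c x y. x < c \<and> y < c \<and> x > y \<and> subseq [c, x, y] w)"
    by (meson less_trans)
  finally show ?thesis by (simp only: word_avoids_def)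
qed

text \<open>Canonical words carry the partitions bijectively to irreducible good words, whose series
  is that of \<open>skew_paths_D\<close> multiplied by \<open>fps_X\<close>.\<close>

lemma (in strict_linear) card_irreducible_avoiding:
  assumes avoid: "\<And>w. rgf w \<Longrightarrow> word_avoids w \<tau> \<longleftrightarrow>
      \<not> (\<exists>c x y. x < c \<and> y < c \<and> R x y \<and> subseq [c, x, y] w)"
    and n: "n \<ge> 1"
  shows "card {P. irreducible_partition (n + 1) P \<and> partition_avoids (n + 1) P \<tau>} =
    card {w. skew_dyck_path w \<and> length w = 2 * n \<and> w \<noteq> [] \<and> last w = Down}"
proof -
  let ?A = "{P. irreducible_partition (n + 1) P \<and> partition_avoids (n + 1) P \<tau>}"
  let ?W = "{w \<in> irreducible_good. length w = n + 1}"
  have P: "partition_on {1..n + 1} Q" if "Q \<in> ?A" for Q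
    using that by (simp add: irreducible_partition_def)
  have sub: "?A \<subseteq> {P. partition_on {1..n + 1} P}" using P by blast
  have W: "P \<in> ?A \<longleftrightarrow> canonical_word (n + 1) P \<in> ?W" if "partition_on {1..n + 1} P" for P
  proof -
    have "canonical_word (n + 1) P \<noteq> []" using length_canonical_word[of "n + 1" P] by auto
    then show ?thesis
      using irreducible_partition_iff[OF that] avoid[OF rgf_canonical_word[OF that]]
        rgf_canonical_word[OF that]
      unfolding partition_avoids_def irreducible_good_def good_def
      by (simp add: length_canonical_word conj_commute)
  qed
  have image: "canonical_word (n + 1) ` ?A = ?W"
  proof (intro equalityI subsetI)
    fix w assume w: "w \<in> ?W"
    then have "w \<in> {w. rgf w \<and> length w = n + 1}" by (simp add: irreducible_good_def good_def)
    then obtain P where "partition_on {1..n + 1} P" "w = canonical_word (n + 1) P"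
      using bij_betw_imp_surj_on[OF bij_betw_canonical_word[of "n + 1"]] by blast
    then show "w \<in> canonical_word (n + 1) ` ?A" using W w by blast
  next
    fix w assume "w \<in> canonical_word (n + 1) ` ?A"
    then show "w \<in> ?W" using W P by blast
  qed
  have "inj_on (canonical_word (n + 1)) ?A"
    using bij_betw_imp_inj_on[OF bij_betw_canonical_word] sub by (rule inj_on_subset)
  then have "card ?A = card ?W" unfolding image[symmetric] by (rule card_image[symmetric])
  also have "?W = {w \<in> irreducible_good. length w = Suc n}" by simp
  also have "card \<dots> = card {w \<in> skew_paths_D. semilength w = n}"
  proof -
    have "(of_nat (card {w \<in> irreducible_good. length w = Suc n}) :: rat) =
        of_nat (card {w \<in> skew_paths_D. semilength w = n})"
      \<comment> \<open>The factor \<open>fps_X\<close> is the shift from semilength n to word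
        length n + 1.\<close>
      using arg_cong[OF gf_irreducible_good[OF gf_skew_paths gf_skew_paths_D],
          of "\<lambda>f. fps_nth f (Suc n)"]
      by (simp add: gf_nth)
    then show ?thesis by simp
  qed
  \<comment> \<open>As n is positive, the empty path in \<open>skew_paths_D\<close> is not
    counted.\<close>
  also have "{w \<in> skew_paths_D. semilength w = n} =
      {w. skew_dyck_path w \<and> length w = 2 * n \<and> w \<noteq> [] \<and> last w = Down}"
    using n length_eq_semilength by (auto simp: skew_paths_D_def skew_dyck_path_iff)
  finally show ?thesis .
qed

theorem corollary9:
  fixes n :: nat
  assumes "n \<ge> 1"
  shows
    "card {P. irreducible_partition (n + 1) P \<and> partition_avoids (n + 1) P [1, 2, 3, 1, 2]} =
       card {w. skew_dyck_path w \<and> length w = 2 * n \<and> w \<noteq> [] \<and> last w = Down} \<and>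
     card {P. irreducible_partition (n + 1) P \<and> partition_avoids (n + 1) P [1, 2, 3, 2, 1]} =
       card {w. skew_dyck_path w \<and> length w = 2 * n \<and> w \<noteq> [] \<and> last w = Down}"
proof
  interpret lt: strict_linear "(<)" by unfold_locales auto
  interpret gt: strict_linear "(>)" by unfold_locales auto
  show "card {P. irreducible_partition (n + 1) P \<and> partition_avoids (n + 1) P [1, 2, 3, 1, 2]} =
      card {w. skew_dyck_path w \<and> length w = 2 * n \<and> w \<noteq> [] \<and> last w = Down}"
    using word_avoids_12312 assms by (rule lt.card_irreducible_avoiding)
  show "card {P. irreducible_partition (n + 1) P \<and> partition_avoids (n + 1) P [1, 2, 3, 2, 1]} =
      card {w. skew_dyck_path w \<and> length w = 2 * n \<and> w \<noteq> [] \<and> last w = Down}"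
    using word_avoids_12321 assms by (rule gt.card_irreducible_avoiding)
qed

end
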